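(* Let $\mathbf{Z}$ be a non-empty measurable space, let $N\ge1$, and let $Z_1,\dots,Z_N$ be exchangeable $\mathbf{Z}$-valued random elements. For any conformal e-test $E:\mathbf{Z}^N\to[0,\infty)$, $E(Z_1,\dots,Z_N)$ is an e-variable, i.e., a nonnegative random variable with $\mathbb{E}(E(Z_1,\dots,Z_N))\le1$. Moreover, $\mathbb{E}(E(Z_1,\dots,Z_N))=1$ if the underlying conformal e-predictor(s) (those defining the basic conformal e-tests of which $E$ is a convex combination) are admissible.
   Context: For a set $X$, $X^+:=\bigcup_{n=1}^\infty X^n$ is the set of non-empty finite sequences of elements of $X$ (a measurable space if $X$ is). A nonconformity e-measure is a measurable function $A:\mathbf{Z}^+\to[0,\infty)^+$ mapping every finite sequence $(z_1,\dots,z_m)$, $m\ge1$, to a sequence $(\alpha_1,\dots,\alpha_m)$ of the same length such that (i) $\frac1m\sum_{i=1}^m\alpha_i\le1$, and (ii) (equivariance) for any $m$ and any permutation $\pi$ of $\{1,\dots,m\}$, if $(\alpha_1,\dots,\alpha_m)=A(z_1,\dots,z_m)$ then $(\alpha_{\pi(1)},\dots,\alpha_{\pi(m)})=A(z_{\pi(1)},\dots,z_{\pi(m)})$. The corresponding conformal e-predictor is $f:\mathbf{Z}^+\to[0,\infty)$, $f(z_1,\dots,z_m):=\alpha_m$ where $(\alpha_1,\dots,\alpha_m)=A(z_1,\dots,z_m)$. Both $A$ and $f$ are called admissible if equality always holds in (i) (for all $m$ and all $(z_1,\dots,z_m)$). A function $E:\mathbf{Z}^N\to[0,\infty)$ is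 a basic conformal e-test if, for some conformal e-predictor $f$, $E(z_1,\dots,z_N)=\prod_{n=1}^N f(z_1,\dots,z_n)$ for all $(z_1,\dots,z_N)\in\mathbf{Z}^N$. A conformal e-test is a finite convex combination $\lambda_1E^{(1)}+\dots+\lambda_kE^{(k)}$ of basic conformal e-tests, where $k\in\{1,2,\dots\}$, $\lambda_i\in[0,1]$, $\lambda_1+\dots+\lambda_k=1$. Random elements $Z_1,\dots,Z_N$ are exchangeable if their joint distribution is invariant under permutations. *)

theory Defs
  imports "HOL-Probability.Probability" "HOL-Combinatorics.Permutations"
begin

text \<open>
  Finite sequences are lists, indexed from 0, so \<open>z\<^sub>1, \<dots>, z\<^sub>m\<close> are
  \<open>zs ! 0, \<dots>, zs ! (m - 1)\<close>.
\<close>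

definition power_seqs :: "'a measure \<Rightarrow> nat \<Rightarrow> 'a list set" where
  "power_seqs S m = {zs. length zs = m \<and> set zs \<subseteq> space S}"

definition plus_seqs :: "'a measure \<Rightarrow> 'a list set" where
  "plus_seqs S = (\<Union>m\<in>{1..}. power_seqs S m)"

text \<open>
  The measurable space of non-empty finite sequences is the disjoint union of the product
  spaces \<open>S\<^sup>m\<close>: a set is measurable iff, for each \<open>m\<close>, its part consisting of sequences of
  length \<open>m\<close> is measurable in the product (lemma \<open>sets_plus_space\<close>).
\<close>

definition plus_space :: "'a measure \<Rightarrow> 'a list measure" where
  "plus_space S = sigma (plus_seqs S)
     {B. B \<subseteq> plus_seqs S \<and>
         (\<forall>m\<ge>1. {x \<in> space (PiM {..<m} (\<lambda>_. S)). map x [0..<m] \<in> B} \<in> sets (PiM {..<m} (\<lambda>_. S)))}"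

lemma map_in_plus_seqs:
  assumes "x \<in> space (PiM {..<m} (\<lambda>_. S))" "m \<ge> 1"
  shows "map x [0..<m] \<in> plus_seqs S"
  using assms by (auto simp: plus_seqs_def power_seqs_def space_PiM PiE_iff)

lemma space_plus_space: "space (plus_space S) = plus_seqs S"
  unfolding plus_space_def by (rule space_measure_of) auto

lemma sets_plus_space:
  "sets (plus_space S) =
     {B. B \<subseteq> plus_seqs S \<and>
         (\<forall>m\<ge>1. {x \<in> space (PiM {..<m} (\<lambda>_. S)). map x [0..<m] \<in> B} \<in> sets (PiM {..<m} (\<lambda>_. S)))}"
  (is "_ = ?C")
proof -
  have "sigma_algebra (plus_seqs S) ?C"
    unfolding sigma_algebra_iff2
  proof (intro conjI ballI allI impI)
    fix B assume B: "B \<in> ?C"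
    have "{x \<in> space (PiM {..<m} (\<lambda>_. S)). map x [0..<m] \<in> plus_seqs S - B}
        \<in> sets (PiM {..<m} (\<lambda>_. S))" if "m \<ge> 1" for m
    proof -
      have "{x \<in> space (PiM {..<m} (\<lambda>_. S)). map x [0..<m] \<in> plus_seqs S - B} =
          space (PiM {..<m} (\<lambda>_. S)) - {x \<in> space (PiM {..<m} (\<lambda>_. S)). map x [0..<m] \<in> B}"
        using map_in_plus_seqs[OF _ that] by auto
      then show ?thesis using B that by auto
    qed
    then show "plus_seqs S - B \<in> ?C" by auto
  next
    fix B :: "nat \<Rightarrow> 'a list set" assume B: "range B \<subseteq> ?C"
    have "{x \<in> space (PiM {..<m} (\<lambda>_. S)). map x [0..<m] \<in> (\<Union>i. B i)}
        \<in> sets (PiM {..<m} (\<lambda>_. S))" if "m \<ge> 1" for m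
    proof -
      have "{x \<in> space (PiM {..<m} (\<lambda>_. S)). map x [0..<m] \<in> (\<Union>i. B i)} =
          (\<Union>i. {x \<in> space (PiM {..<m} (\<lambda>_. S)). map x [0..<m] \<in> B i})"
        by auto
      also have "\<dots> \<in> sets (PiM {..<m} (\<lambda>_. S))"
        using B that by (intro sets.countable_UN) blast
      finally show ?thesis .
    qed
    then show "(\<Union>i. B i) \<in> ?C" using B by blast
  qed auto
  then show ?thesis
    unfolding plus_space_def by (simp add: sigma_algebra.sets_measure_of_eq)
qed

definition nonconformity_e_measure :: "'z measure \<Rightarrow> ('z list \<Rightarrow> real list) \<Rightarrow> bool" where
  "nonconformity_e_measure S A \<longleftrightarrow>
     A \<in> plus_space S \<rightarrow>\<^sub>M plus_space (restrict_space borel {0..}) \<and>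
     (\<forall>zs\<in>plus_seqs S. length (A zs) = length zs) \<and>
     (\<forall>zs\<in>plus_seqs S. (1 / real (length zs)) * sum_list (A zs) \<le> 1) \<and>
     (\<forall>zs\<in>plus_seqs S. \<forall>\<pi>. \<pi> permutes {..<length zs} \<longrightarrow>
        A (permute_list \<pi> zs) = permute_list \<pi> (A zs))"

definition admissible_e_measure :: "'z measure \<Rightarrow> ('z list \<Rightarrow> real list) \<Rightarrow> bool" where
  "admissible_e_measure S A \<longleftrightarrow>
     nonconformity_e_measure S A \<and>
     (\<forall>zs\<in>plus_seqs S. (1 / real (length zs)) * sum_list (A zs) = 1)"

definition corresponding_e_predictor ::
    "'z measure \<Rightarrow> ('z list \<Rightarrow> real list) \<Rightarrow> ('z list \<Rightarrow> real) \<Rightarrow> bool" where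
  "corresponding_e_predictor S A f \<longleftrightarrow> (\<forall>zs\<in>plus_seqs S. f zs = last (A zs))"

definition conformal_e_predictor :: "'z measure \<Rightarrow> ('z list \<Rightarrow> real) \<Rightarrow> bool" where
  "conformal_e_predictor S f \<longleftrightarrow>
     (\<exists>A. nonconformity_e_measure S A \<and> corresponding_e_predictor S A f)"

text \<open>
  By equivariance a conformal e-predictor determines its nonconformity e-measure on
  \<open>plus_seqs S\<close>, so the existential quantifier below involves no choice.
\<close>

definition admissible_e_predictor :: "'z measure \<Rightarrow> ('z list \<Rightarrow> real) \<Rightarrow> bool" where
  "admissible_e_predictor S f \<longleftrightarrow>
     (\<exists>A. admissible_e_measure S A \<and> corresponding_e_predictor S A f)"

definition basic_conformal_e_test_of ::
    "'z measure \<Rightarrow> nat \<Rightarrow> ('z list \<Rightarrow> real) \<Rightarrow> ('z list \<Rightarrow> real) \<Rightarrow> bool" where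
  "basic_conformal_e_test_of S N f E \<longleftrightarrow>
     conformal_e_predictor S f \<and> (\<forall>zs\<in>power_seqs S N. E zs = (\<Prod>n=1..N. f (take n zs)))"

text \<open>
  \<open>E\<close> is the convex combination, with weights \<open>l 0, \<dots>, l (k - 1)\<close>, of the basic conformal
  e-tests with underlying conformal e-predictors \<open>f 0, \<dots>, f (k - 1)\<close>.
\<close>

definition conformal_e_test_of ::
    "'z measure \<Rightarrow> nat \<Rightarrow> nat \<Rightarrow> (nat \<Rightarrow> real) \<Rightarrow> (nat \<Rightarrow> 'z list \<Rightarrow> real) \<Rightarrow> ('z list \<Rightarrow> real) \<Rightarrow> bool" where
  "conformal_e_test_of S N k l f E \<longleftrightarrow>
     k \<ge> 1 \<and> (\<forall>i<k. l i \<in> {0..1}) \<and> (\<Sum>i<k. l i) = 1 \<and>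
     (\<exists>B. (\<forall>i<k. basic_conformal_e_test_of S N (f i) (B i)) \<and>
          (\<forall>zs\<in>power_seqs S N. E zs = (\<Sum>i<k. l i * B i zs)))"

definition conformal_e_test :: "'z measure \<Rightarrow> nat \<Rightarrow> ('z list \<Rightarrow> real) \<Rightarrow> bool" where
  "conformal_e_test S N E \<longleftrightarrow> (\<exists>k l f. conformal_e_test_of S N k l f E)"

definition exchangeable :: "'w measure \<Rightarrow> 'z measure \<Rightarrow> nat \<Rightarrow> (nat \<Rightarrow> 'w \<Rightarrow> 'z) \<Rightarrow> bool" where
  "exchangeable M S N Z \<longleftrightarrow>
     (\<forall>i<N. Z i \<in> M \<rightarrow>\<^sub>M S) \<and>
     (\<forall>\<pi>. \<pi> permutes {..<N} \<longrightarrow>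
        distr M (PiM {..<N} (\<lambda>_. S)) (\<lambda>\<omega>. \<lambda>i\<in>{..<N}. Z (\<pi> i) \<omega>) =
        distr M (PiM {..<N} (\<lambda>_. S)) (\<lambda>\<omega>. \<lambda>i\<in>{..<N}. Z i \<omega>))"

text \<open>
  Integrability is explicit because the Bochner integral of a non-integrable function is 0;
  for a nonnegative random variable it says that the expectation is finite.
\<close>

definition e_variable :: "'w measure \<Rightarrow> ('w \<Rightarrow> real) \<Rightarrow> bool" where
  "e_variable M X \<longleftrightarrow>
     X \<in> borel_measurable M \<and> (\<forall>\<omega>\<in>space M. 0 \<le> X \<omega>) \<and>
     integrable M X \<and> (\<integral>\<omega>. X \<omega> \<partial>M) \<le> 1"

end

theory Submission
  imports Defs
begin

text \<open>
  The idea is to average over all orderings of the data. For a fixed sequence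
  \<open>z\<^sub>1, \<dots>, z\<^sub>n\<close>, group the permutations \<open>\<pi>\<close> by the element \<open>z\<^sub>b\<close> that they put last. By
  equivariance the last factor of the permuted product depends only on \<open>b\<close>: it is the \<open>b\<close>-th
  entry of \<open>A(z\<^sub>1, \<dots>, z\<^sub>n)\<close>. Induction on \<open>n\<close>, applied to the sequence without \<open>z\<^sub>b\<close>, then
  bounds the sum of the products over all permutations by
  \<open>(n - 1)! \<Sum>\<^sub>b A(z\<^sub>1, \<dots>, z\<^sub>n)\<^sub>b \<le> n!\<close>, with equality in the admissible case.
  Exchangeability turns this pointwise inequality into the bound on the expectation.
\<close>

section \<open>Averaging over permutations\<close>

lemma permute_list_in_power_seqs:
  assumes "zs \<in> power_seqs S n" "\<pi> permutes {..<n}"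
  shows "permute_list \<pi> zs \<in> power_seqs S n"
  using assms by (auto simp: power_seqs_def set_permute_list)

lemma take_in_power_seqs:
  assumes "zs \<in> power_seqs S n" "m \<le> n"
  shows "take m zs \<in> power_seqs S m"
  using assms by (auto simp: power_seqs_def dest: in_set_takeD)

lemma power_seqs_subset_plus_seqs: "m \<ge> 1 \<Longrightarrow> power_seqs S m \<subseteq> plus_seqs S"
  by (auto simp: plus_seqs_def)

text \<open>A permutation of \<open>{..<n}\<close> fixes every position from \<open>n\<close> on and
  mixes only the earlier ones, so truncation to the first \<open>n\<close> entries commutes with
  it.\<close>

lemma take_permute_list:
  assumes "q permutes {..<n}" "n \<le> length ys"
  shows "take n (permute_list q ys) = permute_list q (take n ys)"
proof (rule nth_equalityI)
  fix i assume "i < length (take n (permute_list q ys))"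
  then have "i < n" by simp
  moreover then have "q i < n" using permutes_in_image[OF assms(1), of i] by auto
  moreover have "q permutes {..<length ys}"
    using assms by (auto intro: permutes_subset)
  ultimately show "take n (permute_list q ys) ! i = permute_list q (take n ys) ! i"
    using assms by (simp add: permute_list_nth)
qed (use assms in simp)

text \<open>Equivariance moves \<open>p\<close> outside \<open>A\<close>. Position \<open>n\<close>
  is the last one of a list of length \<open>Suc n\<close>, so the predictor sees \<open>p\<close>
  only through the index \<open>p n\<close>; this makes grouping by the last element
  possible.\<close>

lemma e_predictor_permute_list:
  assumes A: "nonconformity_e_measure S A" and f: "corresponding_e_predictor S A f"
    and zs: "zs \<in> power_seqs S (Suc n)" and p: "p permutes {..<Suc n}"
  shows "f (permute_list p zs) = A zs ! p n"
proof -
  have len: "length zs = Suc n" using zs by (simp add: power_seqs_def)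
  have zs': "zs \<in> plus_seqs S" using zs power_seqs_subset_plus_seqs[of "Suc n" S] by auto
  have pz: "permute_list p zs \<in> plus_seqs S"
    using permute_list_in_power_seqs[OF zs p] power_seqs_subset_plus_seqs[of "Suc n" S] by auto
  have lenA: "length (A zs) = Suc n"
    using A zs' len by (simp add: nonconformity_e_measure_def)
  have "f (permute_list p zs) = last (permute_list p (A zs))"
    using A f zs' pz p len
    by (simp add: nonconformity_e_measure_def corresponding_e_predictor_def)
  also have "\<dots> = permute_list p (A zs) ! n"
    using lenA by (subst last_conv_nth) (auto simp flip: length_0_conv)
  also have "\<dots> = A zs ! p n" using lenA p by (simp add: permute_list_nth)
  finally show ?thesis .
qed

text \<open>Each permutation of \<open>{..<Suc n}\<close> is uniquely a transposition of
  \<open>n\<close> and \<open>b\<close> after a permutation \<open>q\<close> of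
  \<open>{..<n}\<close>, where \<open>b\<close> is the image of \<open>n\<close>. The list
  \<open>take n (permute_list (Transposition.transpose n b) zs)\<close> is \<open>zs\<close> without
  its entry \<open>b\<close>: the last entry fills the gap. The first \<open>n\<close> factors see
  only this list, and the remaining factor is \<open>A zs ! b\<close>.\<close>

lemma sum_permutations_prod_Suc:
  fixes f :: "'z list \<Rightarrow> real"
  assumes A: "nonconformity_e_measure S A" and f: "corresponding_e_predictor S A f"
    and zs: "zs \<in> power_seqs S (Suc n)"
  shows "(\<Sum>p | p permutes {..<Suc n}. \<Prod>m=1..Suc n. f (take m (permute_list p zs))) =
    (\<Sum>b<Suc n. A zs ! b * (\<Sum>q | q permutes {..<n}.
       \<Prod>m=1..n. f (take m (permute_list q (take n (permute_list (Transposition.transpose n b) zs))))))"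
proof -
  have len: "length zs = Suc n" using zs by (simp add: power_seqs_def)
  have eq: "(\<Prod>m=1..Suc n. f (take m (permute_list (Transposition.transpose n b \<circ> q) zs))) =
      A zs ! b * (\<Prod>m=1..n. f (take m (permute_list q (take n (permute_list (Transposition.transpose n b) zs)))))"
    if b: "b < Suc n" and q: "q permutes {..<n}" for b q
  proof -
    have q': "q permutes {..<Suc n}" using q by (rule permutes_subset) auto
    have t: "Transposition.transpose n b permutes {..<Suc n}" using b by (intro permutes_swap_id) auto
    have tq: "Transposition.transpose n b \<circ> q permutes {..<Suc n}" using q' t by (rule permutes_compose)
    \<comment> \<open>Hence the composition sends \<open>n\<close> to \<open>b\<close>, whatever
      \<open>q\<close> is.\<close>
    have "q n = n" using q by (auto simp: permutes_def)
    then have last: "f (permute_list (Transposition.transpose n b \<circ> q) zs) = A zs ! b"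
      using e_predictor_permute_list[OF A f zs tq] by simp
    \<comment> \<open>\<open>permute_list\<close> composes indices on the right, so the
      transposition acts on the list first and \<open>q\<close> second.\<close>
    have pl: "permute_list (Transposition.transpose n b \<circ> q) zs =
        permute_list q (permute_list (Transposition.transpose n b) zs)"
      using q' len by (simp add: permute_list_compose)
    have "take m (permute_list (Transposition.transpose n b \<circ> q) zs) =
        take m (permute_list q (take n (permute_list (Transposition.transpose n b) zs)))" if "m \<le> n" for m
    proof -
      have "take m (permute_list (Transposition.transpose n b \<circ> q) zs) =
          take m (take n (permute_list q (permute_list (Transposition.transpose n b) zs)))"
        using that by (simp add: pl min_absorb1)
      then show ?thesis using len by (simp add: take_permute_list[OF q])
    qed
    then have "(\<Prod>m=1..n. f (take m (permute_list (Transposition.transpose n b \<circ> q) zs))) =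
        (\<Prod>m=1..n. f (take m (permute_list q (take n (permute_list (Transposition.transpose n b) zs)))))"
      by (intro prod.cong) auto
    then show ?thesis
      using last len by (simp add: prod.nat_ivl_Suc' mult.commute)
  qed
  have "(\<Sum>p | p permutes insert n {..<n}. \<Prod>m=1..Suc n. f (take m (permute_list p zs))) =
      (\<Sum>b\<in>insert n {..<n}. \<Sum>q | q permutes {..<n}.
        \<Prod>m=1..Suc n. f (take m (permute_list (Transposition.transpose n b \<circ> q) zs)))"
    by (rule sum_over_permutations_insert) auto
  also have "\<dots> = (\<Sum>b<Suc n. \<Sum>q | q permutes {..<n}. A zs ! b *
      (\<Prod>m=1..n. f (take m (permute_list q (take n (permute_list (Transposition.transpose n b) zs))))))"
    unfolding lessThan_Suc[symmetric] by (intro sum.cong refl eq) simp_all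
  finally show ?thesis unfolding lessThan_Suc[symmetric] sum_distrib_left .
qed

text \<open>The sign of the scores is encoded only in the target space of the measurable map
  \<open>A\<close>, whose points are sequences in \<open>{0..}\<close>.\<close>

lemma e_measure_nonneg:
  assumes A: "nonconformity_e_measure S A" and zs: "zs \<in> plus_seqs S" and x: "x \<in> set (A zs)"
  shows "0 \<le> x"
proof -
  have "A zs \<in> plus_seqs (restrict_space borel {0::real..})"
    using A zs unfolding nonconformity_e_measure_def
    by (metis measurable_space space_plus_space)
  then show ?thesis using x by (auto simp: plus_seqs_def power_seqs_def space_restrict_space)
qed

lemma e_predictor_nonneg:
  assumes A: "nonconformity_e_measure S A" and f: "corresponding_e_predictor S A f"
    and zs: "zs \<in> plus_seqs S"
  shows "0 \<le> f zs"
proof -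
  have "length (A zs) = length zs" using A zs by (simp add: nonconformity_e_measure_def)
  moreover have "length zs \<ge> 1" using zs by (auto simp: plus_seqs_def power_seqs_def)
  ultimately have "last (A zs) \<in> set (A zs)" by (intro last_in_set) auto
  then show ?thesis
    using e_measure_nonneg[OF A zs] f zs by (simp add: corresponding_e_predictor_def)
qed

lemma sum_nth_e_measure:
  assumes A: "nonconformity_e_measure S A" and zs: "zs \<in> power_seqs S (Suc n)"
  shows "(\<Sum>b<Suc n. A zs ! b) = sum_list (A zs)" "b < Suc n \<Longrightarrow> 0 \<le> A zs ! b"
proof -
  have zs': "zs \<in> plus_seqs S" using zs power_seqs_subset_plus_seqs[of "Suc n" S] by auto
  have len: "length (A zs) = Suc n"
    using A zs zs' by (simp add: nonconformity_e_measure_def power_seqs_def)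
  show "(\<Sum>b<Suc n. A zs ! b) = sum_list (A zs)"
    by (simp only: sum_list_sum_nth len atLeast0LessThan)
  show "0 \<le> A zs ! b" if "b < Suc n"
    using e_measure_nonneg[OF A zs'] len that by auto
qed

lemma take_transpose_in_power_seqs:
  assumes "zs \<in> power_seqs S (Suc n)" "b < Suc n"
  shows "take n (permute_list (Transposition.transpose n b) zs) \<in> power_seqs S n"
  using assms by (intro take_in_power_seqs[OF permute_list_in_power_seqs] permutes_swap_id) auto

text \<open>The sequence is kept arbitrary in the induction because the hypothesis is applied to a
  different shortened sequence for each \<open>b\<close>. Nonnegativity of \<open>A zs ! b\<close>
  allows multiplying that bound by the score. At \<open>n = 0\<close> there is one permutation and
  an empty product.\<close>

lemma sum_permutations_prod_le_fact:
  fixes f :: "'z list \<Rightarrow> real"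
  assumes A: "nonconformity_e_measure S A" and f: "corresponding_e_predictor S A f"
    and "zs \<in> power_seqs S n"
  shows "(\<Sum>p | p permutes {..<n}. \<Prod>m=1..n. f (take m (permute_list p zs))) \<le> fact n"
  using assms(3)
proof (induction n arbitrary: zs)
  case (Suc n)
  have "zs \<in> plus_seqs S" using Suc.prems power_seqs_subset_plus_seqs[of "Suc n" S] by auto
  then have "1 / real (length zs) * sum_list (A zs) \<le> 1"
    using A by (simp add: nonconformity_e_measure_def)
  then have mean: "sum_list (A zs) \<le> real (Suc n)"
    using Suc.prems by (simp add: power_seqs_def field_simps del: of_nat_Suc)
  have "(\<Sum>p | p permutes {..<Suc n}. \<Prod>m=1..Suc n. f (take m (permute_list p zs))) \<le>
      (\<Sum>b<Suc n. A zs ! b * fact n)"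
    unfolding sum_permutations_prod_Suc[OF A f Suc.prems]
    by (intro sum_mono mult_left_mono Suc.IH take_transpose_in_power_seqs[OF Suc.prems]
        sum_nth_e_measure(2)[OF A Suc.prems]) auto
  also have "\<dots> = sum_list (A zs) * fact n"
    by (simp only: sum_distrib_right[symmetric] sum_nth_e_measure(1)[OF A Suc.prems])
  also have "\<dots> \<le> real (Suc n) * fact n"
    using mean by (intro mult_right_mono) auto
  finally show ?case by (simp only: fact_Suc)
qed simp

text \<open>The same induction: with scores of mean exactly 1, both estimates of the inductive step
  become equalities.\<close>

lemma sum_permutations_prod_eq_fact:
  fixes f :: "'z list \<Rightarrow> real"
  assumes A: "admissible_e_measure S A" and f: "corresponding_e_predictor S A f"
    and "zs \<in> power_seqs S n"
  shows "(\<Sum>p | p permutes {..<n}. \<Prod>m=1..n. f (take m (permute_list p zs))) = fact n"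
  using assms(3)
proof (induction n arbitrary: zs)
  case (Suc n)
  have A': "nonconformity_e_measure S A" using A by (simp add: admissible_e_measure_def)
  have "zs \<in> plus_seqs S" using Suc.prems power_seqs_subset_plus_seqs[of "Suc n" S] by auto
  then have "1 / real (length zs) * sum_list (A zs) = 1"
    using A unfolding admissible_e_measure_def by blast
  then have mean: "sum_list (A zs) = real (Suc n)"
    using Suc.prems by (simp add: power_seqs_def field_simps del: of_nat_Suc)
  have "(\<Sum>p | p permutes {..<Suc n}. \<Prod>m=1..Suc n. f (take m (permute_list p zs))) =
      (\<Sum>b<Suc n. A zs ! b * fact n)"
    unfolding sum_permutations_prod_Suc[OF A' f Suc.prems]
    using Suc.IH[OF take_transpose_in_power_seqs[OF Suc.prems]] by (intro sum.cong) auto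
  also have "\<dots> = real (Suc n) * fact n"
    by (simp only: sum_distrib_right[symmetric] sum_nth_e_measure(1)[OF A' Suc.prems] mean)
  finally show ?case by (simp only: fact_Suc)
qed simp

section \<open>Measurability\<close>

text \<open>The output has fixed length \<open>m\<close>, so only the length-\<open>m\<close> part
  of a measurable set matters, and there measurability is that of the tuple in the product
  space.\<close>

lemma measurable_map_plus_space:
  assumes X: "\<And>i. i < m \<Longrightarrow> X i \<in> M \<rightarrow>\<^sub>M S" and m: "m \<ge> 1"
  shows "(\<lambda>\<omega>. map (\<lambda>i. X i \<omega>) [0..<m]) \<in> M \<rightarrow>\<^sub>M plus_space S"
proof (rule measurableI)
  let ?Y = "\<lambda>\<omega>. \<lambda>i\<in>{..<m}. X i \<omega>"
  have Y: "?Y \<in> M \<rightarrow>\<^sub>M PiM {..<m} (\<lambda>_. S)"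
    using X by (intro measurable_restrict) auto
  have eq: "map (?Y \<omega>) [0..<m] = map (\<lambda>i. X i \<omega>) [0..<m]" for \<omega> by simp
  show "map (\<lambda>i. X i \<omega>) [0..<m] \<in> space (plus_space S)" if "\<omega> \<in> space M" for \<omega>
    using map_in_plus_seqs[OF measurable_space[OF Y that] m] unfolding eq space_plus_space .
  fix B assume "B \<in> sets (plus_space S)"
  then have "{x \<in> space (PiM {..<m} (\<lambda>_. S)). map x [0..<m] \<in> B} \<in> sets (PiM {..<m} (\<lambda>_. S))"
    using m unfolding sets_plus_space by blast
  from measurable_sets[OF Y this]
  show "(\<lambda>\<omega>. map (\<lambda>i. X i \<omega>) [0..<m]) -` B \<inter> space M \<in> sets M"
    by (rule back_subst[of "\<lambda>C. C \<in> sets M"])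
      (use measurable_space[OF Y] in \<open>auto simp: eq\<close>)
qed

text \<open>On sequences of length \<open>m\<close>, \<open>last\<close> is the projection to
  coordinate \<open>m - 1\<close>, so each fixed-length part of a preimage is a measurable
  cylinder.\<close>

lemma measurable_last_plus_space: "last \<in> plus_space S \<rightarrow>\<^sub>M S"
proof (rule measurableI)
  fix zs assume "zs \<in> space (plus_space S)"
  then have "zs \<noteq> []" "set zs \<subseteq> space S"
    by (auto simp: space_plus_space plus_seqs_def power_seqs_def)
  then show "last zs \<in> space S" using last_in_set by blast
next
  fix U assume U: "U \<in> sets S"
  have "{x \<in> space (PiM {..<m} (\<lambda>_. S)). map x [0..<m] \<in> last -` U \<inter> space (plus_space S)}
      \<in> sets (PiM {..<m} (\<lambda>_. S))" if m: "m \<ge> 1" for m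
  proof -
    have "{x \<in> space (PiM {..<m} (\<lambda>_. S)). map x [0..<m] \<in> last -` U \<inter> space (plus_space S)} =
        (\<lambda>x. x (m - 1)) -` U \<inter> space (PiM {..<m} (\<lambda>_. S))"
      using map_in_plus_seqs[OF _ m] m by (auto simp: space_plus_space last_map)
    also have "\<dots> \<in> sets (PiM {..<m} (\<lambda>_. S))"
      using m by (intro measurable_sets[OF _ U] measurable_component_singleton) auto
    finally show ?thesis .
  qed
  then show "last -` U \<inter> space (plus_space S) \<in> sets (plus_space S)"
    unfolding sets_plus_space by (auto simp: space_plus_space)
qed

lemma measurable_e_predictor:
  assumes A: "nonconformity_e_measure S A" and f: "corresponding_e_predictor S A f"
  shows "f \<in> borel_measurable (plus_space S)"
proof -
  \<comment> \<open>The codomain is enlarged from the half-line to all reals.\<close>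
  have "last \<in> plus_space (restrict_space borel {0::real..}) \<rightarrow>\<^sub>M borel"
    using measurable_last_plus_space[of "restrict_space borel {0::real..}"]
    by (simp add: measurable_restrict_space2_iff)
  moreover have "A \<in> plus_space S \<rightarrow>\<^sub>M plus_space (restrict_space borel {0..})"
    using A by (simp add: nonconformity_e_measure_def)
  ultimately have "(\<lambda>zs. last (A zs)) \<in> borel_measurable (plus_space S)"
    by (rule measurable_compose_rev)
  then show ?thesis
    using f by (subst measurable_cong[of _ _ "\<lambda>zs. last (A zs)"])
      (auto simp: space_plus_space corresponding_e_predictor_def)
qed

text \<open>Each factor applies \<open>f\<close> to a prefix, itself a tuple of fixed length
  \<open>n\<close>. The family \<open>X\<close> is general so as to cover both the coordinates of
  the product space and the data \<open>Z\<close>.\<close>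

lemma measurable_prod_e_predictor:
  assumes A: "nonconformity_e_measure S A" and f: "corresponding_e_predictor S A f"
    and X: "\<And>i. i < N \<Longrightarrow> X i \<in> M \<rightarrow>\<^sub>M S"
  shows "(\<lambda>\<omega>. \<Prod>n=1..N. f (take n (map (\<lambda>i. X i \<omega>) [0..<N]))) \<in> borel_measurable M"
proof (rule borel_measurable_prod)
  fix n assume n: "n \<in> {1..N}"
  have "(\<lambda>\<omega>. map (\<lambda>i. X i \<omega>) [0..<n]) \<in> M \<rightarrow>\<^sub>M plus_space S"
    using X n by (intro measurable_map_plus_space) auto
  then have "(\<lambda>\<omega>. f (map (\<lambda>i. X i \<omega>) [0..<n])) \<in> borel_measurable M"
    using measurable_e_predictor[OF A f] by (rule measurable_compose)
  then show "(\<lambda>\<omega>. f (take n (map (\<lambda>i. X i \<omega>) [0..<N]))) \<in> borel_measurable M"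
    using n by (simp add: take_map)
qed

section \<open>Expectations under exchangeability\<close>

lemma exchangeable_map_in_power_seqs:
  assumes "exchangeable M S N Z" "\<omega> \<in> space M"
  shows "map (\<lambda>i. Z i \<omega>) [0..<N] \<in> power_seqs S N"
  using assms by (auto simp: exchangeable_def power_seqs_def intro: measurable_space)

text \<open>Both integrals are integrals of the same function against laws that exchangeability
  identifies. Values in \<open>ennreal\<close> allow the comparison before any expectation is known
  to be finite.\<close>

lemma nn_integral_exchangeable:
  fixes G :: "'z list \<Rightarrow> ennreal"
  assumes ex: "exchangeable M S N Z"
    and G: "(\<lambda>x. G (map x [0..<N])) \<in> borel_measurable (PiM {..<N} (\<lambda>_. S))"
    and p: "p permutes {..<N}"
  shows "(\<integral>\<^sup>+\<omega>. G (permute_list p (map (\<lambda>i. Z i \<omega>) [0..<N])) \<partial>M) =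
    (\<integral>\<^sup>+\<omega>. G (map (\<lambda>i. Z i \<omega>) [0..<N]) \<partial>M)"
    and "(\<lambda>\<omega>. G (permute_list p (map (\<lambda>i. Z i \<omega>) [0..<N]))) \<in> borel_measurable M"
proof -
  have p_less: "p i < N" if "i < N" for i
    using permutes_in_image[OF p, of i] that by auto
  have Z: "Z i \<in> M \<rightarrow>\<^sub>M S" if "i < N" for i using ex that by (simp add: exchangeable_def)
  have m1: "(\<lambda>\<omega>. \<lambda>i\<in>{..<N}. Z (p i) \<omega>) \<in> M \<rightarrow>\<^sub>M PiM {..<N} (\<lambda>_. S)"
    using Z p_less by (intro measurable_restrict) auto
  have m2: "(\<lambda>\<omega>. \<lambda>i\<in>{..<N}. Z i \<omega>) \<in> M \<rightarrow>\<^sub>M PiM {..<N} (\<lambda>_. S)"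
    using Z by (intro measurable_restrict) auto
  \<comment> \<open>Permuting the observed list is reindexing the random elements, the form in which
    exchangeability is stated.\<close>
  have perm: "permute_list p (map (\<lambda>i. Z i \<omega>) [0..<N]) =
      map (\<lambda>i\<in>{..<N}. Z (p i) \<omega>) [0..<N]" for \<omega>
    using p_less by (auto simp: permute_list_def)
  have id: "map (\<lambda>i. Z i \<omega>) [0..<N] = map (\<lambda>i\<in>{..<N}. Z i \<omega>) [0..<N]" for \<omega>
    by auto
  show "(\<lambda>\<omega>. G (permute_list p (map (\<lambda>i. Z i \<omega>) [0..<N]))) \<in> borel_measurable M"
    unfolding perm using m1 G by (rule measurable_compose)
  have "(\<integral>\<^sup>+\<omega>. G (permute_list p (map (\<lambda>i. Z i \<omega>) [0..<N])) \<partial>M) =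
      (\<integral>\<^sup>+x. G (map x [0..<N]) \<partial>distr M (PiM {..<N} (\<lambda>_. S)) (\<lambda>\<omega>. \<lambda>i\<in>{..<N}. Z (p i) \<omega>))"
    unfolding perm by (rule nn_integral_distr[OF m1, symmetric]) (use G in simp)
  also have "\<dots> =
      (\<integral>\<^sup>+x. G (map x [0..<N]) \<partial>distr M (PiM {..<N} (\<lambda>_. S)) (\<lambda>\<omega>. \<lambda>i\<in>{..<N}. Z i \<omega>))"
    using ex p by (simp add: exchangeable_def)
  also have "\<dots> = (\<integral>\<^sup>+\<omega>. G (map (\<lambda>i. Z i \<omega>) [0..<N]) \<partial>M)"
    by (subst id, rule nn_integral_distr[OF m2]) (use G in simp)
  finally show "(\<integral>\<^sup>+\<omega>. G (permute_list p (map (\<lambda>i. Z i \<omega>) [0..<N])) \<partial>M) =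
      (\<integral>\<^sup>+\<omega>. G (map (\<lambda>i. Z i \<omega>) [0..<N]) \<partial>M)" .
qed

text \<open>All \<open>fact N\<close> permuted integrals coincide, so their sum is a multiple of one
  of them; linearity moves the sum under the integral, where pointwise bounds apply.\<close>

lemma fact_times_nn_integral_exchangeable:
  fixes G :: "'z list \<Rightarrow> ennreal"
  assumes ex: "exchangeable M S N Z"
    and G: "(\<lambda>x. G (map x [0..<N])) \<in> borel_measurable (PiM {..<N} (\<lambda>_. S))"
  shows "fact N * (\<integral>\<^sup>+\<omega>. G (map (\<lambda>i. Z i \<omega>) [0..<N]) \<partial>M) =
    (\<integral>\<^sup>+\<omega>. (\<Sum>p | p permutes {..<N}. G (permute_list p (map (\<lambda>i. Z i \<omega>) [0..<N]))) \<partial>M)"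
proof -
  have "(\<integral>\<^sup>+\<omega>. (\<Sum>p | p permutes {..<N}. G (permute_list p (map (\<lambda>i. Z i \<omega>) [0..<N]))) \<partial>M) =
      (\<Sum>p | p permutes {..<N}. \<integral>\<^sup>+\<omega>. G (permute_list p (map (\<lambda>i. Z i \<omega>) [0..<N])) \<partial>M)"
    by (intro nn_integral_sum nn_integral_exchangeable(2)[OF ex G]) auto
  also have "\<dots> = (\<Sum>p | p permutes {..<N}. \<integral>\<^sup>+\<omega>. G (map (\<lambda>i. Z i \<omega>) [0..<N]) \<partial>M)"
    by (intro sum.cong nn_integral_exchangeable(1)[OF ex G]) auto
  also have "\<dots> = fact N * (\<integral>\<^sup>+\<omega>. G (map (\<lambda>i. Z i \<omega>) [0..<N]) \<partial>M)"
    by (simp add: card_permutations[of "{..<N}" N])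
  finally show ?thesis ..
qed

lemma fact_times_nn_integral_prod_e_predictor:
  fixes f :: "'z list \<Rightarrow> real"
  assumes ex: "exchangeable M S N Z"
    and A: "nonconformity_e_measure S A" and f: "corresponding_e_predictor S A f"
  shows "fact N * (\<integral>\<^sup>+\<omega>. ennreal (\<Prod>n=1..N. f (take n (map (\<lambda>i. Z i \<omega>) [0..<N]))) \<partial>M) =
    (\<integral>\<^sup>+\<omega>. ennreal (\<Sum>p | p permutes {..<N}.
       \<Prod>n=1..N. f (take n (permute_list p (map (\<lambda>i. Z i \<omega>) [0..<N])))) \<partial>M)"
proof -
  let ?G = "\<lambda>zs. ennreal (\<Prod>n=1..N. f (take n zs))"
  have "(\<lambda>x. \<Prod>n=1..N. f (take n (map (\<lambda>i. x i) [0..<N]))) \<in>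
      borel_measurable (PiM {..<N} (\<lambda>_. S))"
    by (rule measurable_prod_e_predictor[OF A f]) auto
  then have "(\<lambda>x. ?G (map x [0..<N])) \<in> borel_measurable (PiM {..<N} (\<lambda>_. S))" by simp
  note fact_times_nn_integral_exchangeable[OF ex this]
  also have "(\<integral>\<^sup>+\<omega>. (\<Sum>p | p permutes {..<N}. ?G (permute_list p (map (\<lambda>i. Z i \<omega>) [0..<N]))) \<partial>M) =
    (\<integral>\<^sup>+\<omega>. ennreal (\<Sum>p | p permutes {..<N}.
       \<Prod>n=1..N. f (take n (permute_list p (map (\<lambda>i. Z i \<omega>) [0..<N])))) \<partial>M)"
  \<comment> \<open>Pulling the sum inside \<open>ennreal\<close> requires every product to be
    nonnegative, since \<open>ennreal\<close> sends negative reals to 0.\<close>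
  proof (intro nn_integral_cong sum_ennreal prod_nonneg ballI e_predictor_nonneg[OF A f])
    fix \<omega> p n assume *: "\<omega> \<in> space M" "p \<in> {p. p permutes {..<N}}" "n \<in> {1..N}"
    have "map (\<lambda>i. Z i \<omega>) [0..<N] \<in> power_seqs S N"
      by (rule exchangeable_map_in_power_seqs[OF ex]) fact
    then have "take n (permute_list p (map (\<lambda>i. Z i \<omega>) [0..<N])) \<in> power_seqs S n"
      using * by (intro take_in_power_seqs[OF permute_list_in_power_seqs]) auto
    then show "take n (permute_list p (map (\<lambda>i. Z i \<omega>) [0..<N])) \<in> plus_seqs S"
      using power_seqs_subset_plus_seqs[of n S] * by auto
  qed
  finally show ?thesis .
qed

section \<open>Expectation of a basic conformal e-test\<close>

lemma ennreal_fact_mult_le_iff: "fact N * (x :: ennreal) \<le> ennreal (fact N) \<longleftrightarrow> x \<le> 1"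
proof -
  have "fact N = ennreal (fact N)"
    by (metis ennreal_of_nat_eq_real_of_nat of_nat_fact)
  \<comment> \<open>The factor is neither 0 nor infinite, so it cancels.\<close>
  then show ?thesis
    using ennreal_mult_le_mult_iff[of "ennreal (fact N)" x 1] by simp
qed

lemma e_variable_basic_conformal_e_test:
  assumes "prob_space M" and ex: "exchangeable M S N Z"
    and E: "basic_conformal_e_test_of S N f E"
  shows "e_variable M (\<lambda>\<omega>. E (map (\<lambda>i. Z i \<omega>) [0..<N]))"
proof -
  interpret prob_space M by fact
  let ?z = "\<lambda>\<omega>. map (\<lambda>i. Z i \<omega>) [0..<N]"
  obtain A where A: "nonconformity_e_measure S A" and f: "corresponding_e_predictor S A f"
    using E by (auto simp: basic_conformal_e_test_of_def conformal_e_predictor_def)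
  have z: "?z \<omega> \<in> power_seqs S N" if "\<omega> \<in> space M" for \<omega>
    using exchangeable_map_in_power_seqs[OF ex that] .
  have E_eq: "E (?z \<omega>) = (\<Prod>n=1..N. f (take n (?z \<omega>)))" if "\<omega> \<in> space M" for \<omega>
    using E z[OF that] by (simp add: basic_conformal_e_test_of_def)
  have meas: "(\<lambda>\<omega>. E (?z \<omega>)) \<in> borel_measurable M"
    using measurable_prod_e_predictor[OF A f, of N Z M] ex E_eq
    by (subst measurable_cong[OF E_eq]) (auto simp: exchangeable_def)
  have nonneg: "0 \<le> E (?z \<omega>)" if "\<omega> \<in> space M" for \<omega>
    unfolding E_eq[OF that]
  proof (intro prod_nonneg ballI e_predictor_nonneg[OF A f])
    fix n assume "n \<in> {1..N}"
    then show "take n (?z \<omega>) \<in> plus_seqs S"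
      using take_in_power_seqs[OF z[OF that], of n] power_seqs_subset_plus_seqs[of n S] by auto
  qed
  have "fact N * (\<integral>\<^sup>+\<omega>. ennreal (E (?z \<omega>)) \<partial>M) =
      fact N * (\<integral>\<^sup>+\<omega>. ennreal (\<Prod>n=1..N. f (take n (?z \<omega>))) \<partial>M)"
    using E_eq by (intro arg_cong2[where f = "(*)"] nn_integral_cong) auto
  also have "\<dots> = (\<integral>\<^sup>+\<omega>. ennreal (\<Sum>p | p permutes {..<N}.
       \<Prod>n=1..N. f (take n (permute_list p (?z \<omega>)))) \<partial>M)"
    by (rule fact_times_nn_integral_prod_e_predictor[OF ex A f])
  also have "\<dots> \<le> (\<integral>\<^sup>+\<omega>. ennreal (fact N) \<partial>M)"
    by (intro nn_integral_mono ennreal_leI sum_permutations_prod_le_fact[OF A f] z)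
  also have "\<dots> = ennreal (fact N)" by (simp add: emeasure_space_1)
  finally have le: "(\<integral>\<^sup>+\<omega>. ennreal (E (?z \<omega>)) \<partial>M) \<le> 1"
    by (simp only: ennreal_fact_mult_le_iff)
  \<comment> \<open>Integrability is a consequence of the bound just obtained; only then does the
    Bochner integral agree with the nonnegative one.\<close>
  have int: "integrable M (\<lambda>\<omega>. E (?z \<omega>))"
    using meas nonneg le by (intro integrableI_nonneg) (auto simp: order_le_less_trans)
  then have "ennreal (\<integral>\<omega>. E (?z \<omega>) \<partial>M) \<le> 1"
    using le nonneg by (subst nn_integral_eq_integral[symmetric]) auto
  then show ?thesis
    using meas nonneg int by (auto simp: e_variable_def)
qed

lemma expectation_admissible_basic_conformal_e_test:
  assumes "prob_space M" and ex: "exchangeable M S N Z"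
    and E: "basic_conformal_e_test_of S N f E" and adm: "admissible_e_predictor S f"
  shows "(\<integral>\<omega>. E (map (\<lambda>i. Z i \<omega>) [0..<N]) \<partial>M) = 1"
proof -
  interpret prob_space M by fact
  let ?z = "\<lambda>\<omega>. map (\<lambda>i. Z i \<omega>) [0..<N]"
  \<comment> \<open>This \<open>A\<close> is the admissible witness, rather than the one hidden in
    the assumption on \<open>E\<close>; \<open>E\<close> is given through \<open>f\<close> alone, so
    the product formula still applies.\<close>
  obtain A where A: "admissible_e_measure S A" and f: "corresponding_e_predictor S A f"
    using adm by (auto simp: admissible_e_predictor_def)
  have A': "nonconformity_e_measure S A" using A by (simp add: admissible_e_measure_def)
  have z: "?z \<omega> \<in> power_seqs S N" if "\<omega> \<in> space M" for \<omega>
    using exchangeable_map_in_power_seqs[OF ex that] .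
  have e: "e_variable M (\<lambda>\<omega>. E (?z \<omega>))"
    by (rule e_variable_basic_conformal_e_test[OF assms(1-3)])
  have "fact N * (\<integral>\<^sup>+\<omega>. ennreal (E (?z \<omega>)) \<partial>M) =
      fact N * (\<integral>\<^sup>+\<omega>. ennreal (\<Prod>n=1..N. f (take n (?z \<omega>))) \<partial>M)"
    using E z by (intro arg_cong2[where f = "(*)"] nn_integral_cong)
      (auto simp: basic_conformal_e_test_of_def)
  also have "\<dots> = (\<integral>\<^sup>+\<omega>. ennreal (\<Sum>p | p permutes {..<N}.
       \<Prod>n=1..N. f (take n (permute_list p (?z \<omega>)))) \<partial>M)"
    by (rule fact_times_nn_integral_prod_e_predictor[OF ex A' f])
  also have "\<dots> = (\<integral>\<^sup>+\<omega>. ennreal (fact N) \<partial>M)"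
    by (intro nn_integral_cong arg_cong[where f = ennreal] sum_permutations_prod_eq_fact[OF A f] z)
  also have "\<dots> = ennreal (fact N)" by (simp add: emeasure_space_1)
  also have "(\<integral>\<^sup>+\<omega>. ennreal (E (?z \<omega>)) \<partial>M) = ennreal (\<integral>\<omega>. E (?z \<omega>) \<partial>M)"
    using e by (intro nn_integral_eq_integral) (auto simp: e_variable_def)
  also have "fact N = ennreal (fact N)"
    by (metis ennreal_of_nat_eq_real_of_nat of_nat_fact)
  finally have "ennreal (fact N * (\<integral>\<omega>. E (?z \<omega>) \<partial>M)) = ennreal (fact N)"
    by (simp add: ennreal_mult')
  \<comment> \<open>\<open>ennreal\<close> is injective only on nonnegative reals, so the sign is
    needed to return to an equation of reals.\<close>
  moreover have "0 \<le> (\<integral>\<omega>. E (?z \<omega>) \<partial>M)"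
    using e by (intro integral_nonneg_AE) (auto simp: e_variable_def)
  ultimately show ?thesis by simp
qed

section \<open>Passage to convex combinations\<close>

theorem proposition3:
  fixes M :: "'w measure" and S :: "'z measure" and N :: nat
    and Z :: "nat \<Rightarrow> 'w \<Rightarrow> 'z" and E :: "'z list \<Rightarrow> real"
  assumes "prob_space M"
    and "space S \<noteq> {}"
    and "N \<ge> 1"
    and "exchangeable M S N Z"
    and "conformal_e_test S N E"
  shows "e_variable M (\<lambda>\<omega>. E (map (\<lambda>i. Z i \<omega>) [0..<N])) \<and>
    (\<forall>k l f. conformal_e_test_of S N k l f E \<longrightarrow> (\<forall>i<k. admissible_e_predictor S (f i)) \<longrightarrow>
       (\<integral>\<omega>. E (map (\<lambda>i. Z i \<omega>) [0..<N]) \<partial>M) = 1)"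
proof -
  note ex = \<open>exchangeable M S N Z\<close>
  let ?z = "\<lambda>\<omega>. map (\<lambda>i. Z i \<omega>) [0..<N]"
  \<comment> \<open>Both claims are shown for an arbitrary representation of \<open>E\<close>: the
    first then needs one that exists by assumption, while the second ranges over all of
    them.\<close>
  have *: "e_variable M (\<lambda>\<omega>. E (?z \<omega>)) \<and>
      ((\<forall>i<k. admissible_e_predictor S (f i)) \<longrightarrow> (\<integral>\<omega>. E (?z \<omega>) \<partial>M) = 1)"
    if test: "conformal_e_test_of S N k l f E" for k l f
  proof -
    obtain B where l: "\<And>i. i < k \<Longrightarrow> 0 \<le> l i" and l1: "(\<Sum>i<k. l i) = 1"
      and B: "\<And>i. i < k \<Longrightarrow> basic_conformal_e_test_of S N (f i) (B i)"
      and E: "\<And>zs. zs \<in> power_seqs S N \<Longrightarrow> E zs = (\<Sum>i<k. l i * B i zs)"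
      using test unfolding conformal_e_test_of_def by auto
    have eB: "e_variable M (\<lambda>\<omega>. B i (?z \<omega>))" if "i < k" for i
      using e_variable_basic_conformal_e_test[OF \<open>prob_space M\<close> ex B[OF that]] .
    have E_eq: "E (?z \<omega>) = (\<Sum>i<k. l i * B i (?z \<omega>))" if "\<omega> \<in> space M" for \<omega>
      using E exchangeable_map_in_power_seqs[OF ex that] .
    have int: "integrable M (\<lambda>\<omega>. E (?z \<omega>))"
      using eB by (subst Bochner_Integration.integrable_cong[OF refl E_eq])
        (auto simp: e_variable_def)
    have "(\<integral>\<omega>. E (?z \<omega>) \<partial>M) = (\<integral>\<omega>. (\<Sum>i<k. l i * B i (?z \<omega>)) \<partial>M)"
      using E_eq by (intro Bochner_Integration.integral_cong) auto
    also have "\<dots> = (\<Sum>i<k. l i * (\<integral>\<omega>. B i (?z \<omega>) \<partial>M))"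
      using eB by (subst Bochner_Integration.integral_sum) (auto simp: e_variable_def)
    \<comment> \<open>This equation serves twice: expectations at most 1 give the bound, and
      expectations equal to 1 give the admissible case, as the weights sum to 1.\<close>
    finally have exp: "(\<integral>\<omega>. E (?z \<omega>) \<partial>M) = (\<Sum>i<k. l i * (\<integral>\<omega>. B i (?z \<omega>) \<partial>M))" .
    also have "\<dots> \<le> (\<Sum>i<k. l i * 1)"
      using eB l by (intro sum_mono mult_left_mono) (auto simp: e_variable_def)
    finally have "(\<integral>\<omega>. E (?z \<omega>) \<partial>M) \<le> 1" using l1 by simp
    moreover have "0 \<le> E (?z \<omega>)" if "\<omega> \<in> space M" for \<omega>
      unfolding E_eq[OF that] using l eB that
      by (intro sum_nonneg mult_nonneg_nonneg) (auto simp: e_variable_def)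
    ultimately have "e_variable M (\<lambda>\<omega>. E (?z \<omega>))"
      using int by (auto simp: e_variable_def)
    moreover have "(\<integral>\<omega>. E (?z \<omega>) \<partial>M) = 1" if "\<forall>i<k. admissible_e_predictor S (f i)"
    proof -
      have "(\<integral>\<omega>. B i (?z \<omega>) \<partial>M) = 1" if "i < k" for i
        using expectation_admissible_basic_conformal_e_test[OF \<open>prob_space M\<close> ex B[OF that]]
          \<open>\<forall>i<k. admissible_e_predictor S (f i)\<close> that by blast
      then show ?thesis unfolding exp using l1 by simp
    qed
    ultimately show ?thesis by blast
  qed
  show ?thesis
    using * \<open>conformal_e_test S N E\<close> unfolding conformal_e_test_def by blast
qed

end
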